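(* Let $K$ be a field, let $r\ge s\ge 2$ be integers, and let $$T=K[x_iy_j:1\le i\le r,\ 1\le j\le s]\subset K[x_1,\dots,x_r,y_1,\dots,y_s]$$ be the Segre product of the polynomial rings $K[x_1,\dots,x_r]$ and $K[y_1,\dots,y_s]$. Let $I\subset T$ be the ideal $$I=(x_1^{r-s}y^{\beta} : \beta\in\mathbb N^s,\ |\beta|=r-s)\subset T.$$ Then $I^{-1}$ is generated as a $T$-module by the fractions $x^{\alpha}/x_1^{r-s}$ with $\alpha\in\mathbb N^r$ and $|\alpha|=r-s$.
   Context: For $\alpha=(a_1,\dots,a_r)\in\mathbb N^r$ we write $x^\alpha=x_1^{a_1}\cdots x_r^{a_r}$ and $|\alpha|=\sum_i a_i$, and similarly $y^\beta$, $|\beta|$ for $\beta\in\mathbb N^s$. $I^{-1}=\{z\in Q(T): zI\subseteq T\}$, where $Q(T)$ is the field of fractions of $T$. (The ideal $I$ is isomorphic to the canonical module of $T$, so $I^{-1}$ is the anti-canonical ideal of $T$.) *)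

theory Defs
  imports
    "HOL.Hull"
    "HOL-Library.Poly_Mapping"
    "HOL-Computational_Algebra.Polynomial_Factorial"
begin

text \<open>
  Polynomials are finitely supported maps from monomials (finitely supported exponent vectors)
  to coefficients. The ambient ring has all variables \<open>VX i\<close>, \<open>VY j\<close> with \<open>i\<close>, \<open>j\<close> natural
  numbers; the parameters \<open>r\<close> and \<open>s\<close> only bound which of them (numbered from 1) are used.
\<close>

datatype var = VX nat | VY nat

text \<open>The order on variables plays no role in the mathematics: the library shows that
  a polynomial ring is an integral domain only when the variables are linearly ordered.\<close>

instantiation var :: linorder
begin

fun less_eq_var :: "var \<Rightarrow> var \<Rightarrow> bool" where
  "VX i \<le> VX j \<longleftrightarrow> i \<le> j"
| "VX i \<le> VY j \<longleftrightarrow> True"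
| "VY i \<le> VX j \<longleftrightarrow> False"
| "VY i \<le> VY j \<longleftrightarrow> i \<le> j"

definition less_var :: "var \<Rightarrow> var \<Rightarrow> bool" where
  "less_var u v \<longleftrightarrow> u \<le> v \<and> \<not> v \<le> u"

instance
proof
  fix u v w :: var
  show "u < v \<longleftrightarrow> u \<le> v \<and> \<not> v \<le> u"
    by (rule less_var_def)
  show "u \<le> u"
    by (cases u) auto
  show "u \<le> w" if "u \<le> v" "v \<le> w"
    using that by (cases u; cases v; cases w) auto
  show "u = v" if "u \<le> v" "v \<le> u"
    using that by (cases u; cases v) auto
  show "u \<le> v \<or> v \<le> u"
    by (cases u; cases v) auto
qed

end

type_synonym 'k mpoly = "(var \<Rightarrow>\<^sub>0 nat) \<Rightarrow>\<^sub>0 'k"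

definition const :: "'k \<Rightarrow> 'k::field mpoly" where
  "const c = Poly_Mapping.single 0 c"

definition xvar :: "nat \<Rightarrow> 'k::field mpoly" where
  "xvar i = Poly_Mapping.single (Poly_Mapping.single (VX i) 1) 1"

definition yvar :: "nat \<Rightarrow> 'k::field mpoly" where
  "yvar j = Poly_Mapping.single (Poly_Mapping.single (VY j) 1) 1"

text \<open>Exponent vectors of length \<open>n\<close> are functions on natural numbers of which only
  the values at \<open>1, \<dots>, n\<close> are used.\<close>

definition xmonom :: "nat \<Rightarrow> (nat \<Rightarrow> nat) \<Rightarrow> 'k::field mpoly" where
  "xmonom r \<alpha> = (\<Prod>i=1..r. xvar i ^ \<alpha> i)"

definition ymonom :: "nat \<Rightarrow> (nat \<Rightarrow> nat) \<Rightarrow> 'k::field mpoly" where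
  "ymonom s \<beta> = (\<Prod>j=1..s. yvar j ^ \<beta> j)"

definition subalgebra :: "'k::field mpoly set \<Rightarrow> bool" where
  "subalgebra A \<longleftrightarrow> range const \<subseteq> A \<and>
     (\<forall>f\<in>A. \<forall>g\<in>A. f + g \<in> A) \<and> (\<forall>f\<in>A. \<forall>g\<in>A. f * g \<in> A)"

definition segre :: "nat \<Rightarrow> nat \<Rightarrow> 'k::field mpoly set" where
  "segre r s = subalgebra hull {xvar i * yvar j | i j. i \<in> {1..r} \<and> j \<in> {1..s}}"

text \<open>Submodules, over a subring \<open>R\<close> of a commutative ring, of that ring. Closure under
  negation follows from \<open>-1 \<in> R\<close>.\<close>

definition submodule :: "'a::comm_ring_1 set \<Rightarrow> 'a set \<Rightarrow> bool" where
  "submodule R M \<longleftrightarrow> 0 \<in> M \<and> (\<forall>a\<in>M. \<forall>b\<in>M. a + b \<in> M) \<and> (\<forall>c\<in>R. \<forall>a\<in>M. c * a \<in> M)"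

definition ideal_of :: "'a::comm_ring_1 set \<Rightarrow> 'a set \<Rightarrow> bool" where
  "ideal_of R J \<longleftrightarrow> J \<subseteq> R \<and> submodule R J"

definition canon_ideal :: "nat \<Rightarrow> nat \<Rightarrow> 'k::field mpoly set" where
  "canon_ideal r s = ideal_of (segre r s) hull
     {xvar 1 ^ (r - s) * ymonom s \<beta> | \<beta>. (\<Sum>j=1..s. \<beta> j) = r - s}"

text \<open>The field of fractions of a subring \<open>R\<close>, inside the field of fractions of the
  ambient domain.\<close>

definition fraction_field :: "'a::idom set \<Rightarrow> 'a fract set" where
  "fraction_field R = {Fract a b | a b. a \<in> R \<and> b \<in> R \<and> b \<noteq> 0}"

definition ideal_inverse :: "'a::idom set \<Rightarrow> 'a set \<Rightarrow> 'a fract set" where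
  "ideal_inverse R J = {z \<in> fraction_field R. \<forall>a\<in>J. z * to_fract a \<in> to_fract ` R}"

text \<open>The generators used in \<^const>\<open>canon_ideal\<close> do lie in \<^const>\<open>segre\<close>, so that the
  ideal is well defined.\<close>

lemma subalgebra_segre: "subalgebra (segre r s)"
  unfolding segre_def by (rule hull_in) (simp add: subalgebra_def image_subset_iff)

lemma one_in_segre: "1 \<in> segre r s"
proof -
  have "const 1 \<in> segre r s"
    using subalgebra_segre[of r s] unfolding subalgebra_def by blast
  then show ?thesis
    by (simp add: const_def)
qed

lemma mult_in_segre: "f \<in> segre r s \<Longrightarrow> g \<in> segre r s \<Longrightarrow> f * g \<in> segre r s"
  using subalgebra_segre[of r s] unfolding subalgebra_def by blast

lemma power_in_segre: "f \<in> segre r s \<Longrightarrow> f ^ n \<in> segre r s"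
  by (induction n) (auto simp: one_in_segre mult_in_segre)

lemma prod_in_segre:
  assumes "\<And>i. i \<in> S \<Longrightarrow> f i \<in> segre r s"
  shows "prod f S \<in> segre r s"
  using assms by (induction S rule: infinite_finite_induct) (auto simp: one_in_segre mult_in_segre)

lemma canon_generator_in_segre:
  assumes "1 \<le> r" "(\<Sum>j=1..s. \<beta> j) = n"
  shows "xvar 1 ^ n * ymonom s \<beta> \<in> (segre r s :: 'k::field mpoly set)"
proof -
  have "(xvar 1 ^ n * ymonom s \<beta> :: 'k mpoly) = (\<Prod>j=1..s. (xvar 1 * yvar j) ^ \<beta> j)"
    using assms(2) by (simp add: ymonom_def power_mult_distrib prod.distrib flip: power_sum)
  moreover have "xvar 1 * yvar j \<in> (segre r s :: 'k mpoly set)" if "j \<in> {1..s}" for j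
    using that assms(1) unfolding segre_def by (intro hull_inc) fastforce
  then have "(\<Prod>j=1..s. (xvar 1 * yvar j) ^ \<beta> j) \<in> (segre r s :: 'k mpoly set)"
    by (intro prod_in_segre power_in_segre)
  ultimately show ?thesis
    by simp
qed

lemma ideal_of_canon_ideal:
  assumes "1 \<le> r"
  shows "ideal_of (segre r s) (canon_ideal r s :: 'k::field mpoly set)"
proof -
  let ?T = "segre r s :: 'k mpoly set" and ?I = "canon_ideal r s :: 'k mpoly set"
  let ?G = "{xvar 1 ^ (r - s) * ymonom s \<beta> | \<beta>. (\<Sum>j=1..s. \<beta> j) = r - s} :: 'k mpoly set"
  have "ideal_of ?T ?T"
    using subalgebra_segre[of r s]
    by (auto simp: ideal_of_def submodule_def subalgebra_def const_def image_subset_iff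
        dest: spec[of _ 0])
  moreover have "?G \<subseteq> ?T"
    using canon_generator_in_segre[OF assms] by blast
  ultimately have "?I \<subseteq> ?T"
    unfolding canon_ideal_def by (rule hull_minimal[rotated])
  moreover have "submodule ?T ?I"
    unfolding canon_ideal_def hull_def submodule_def ideal_of_def by blast
  ultimately show ?thesis
    by (simp add: ideal_of_def)
qed

end

theory Submission
  imports Defs
begin

text \<open>
  Put \<open>n = r - s\<close> and let \<open>z\<close> lie in the inverse of \<open>I\<close>. Then \<open>f = z x\<^sub>1\<^sup>n y\<^sub>1\<^sup>n\<close> and
  \<open>g = z x\<^sub>1\<^sup>n y\<^sub>2\<^sup>n\<close> lie in \<open>T\<close>, and \<open>f y\<^sub>2\<^sup>n = g y\<^sub>1\<^sup>n\<close> shows that \<open>y\<^sub>1\<^sup>n\<close> divides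
  every monomial of \<open>f\<close>. Since \<open>T\<close> is spanned by the monomials whose \<open>x\<close>-degree and \<open>y\<close>-degree agree,
  each monomial of \<open>f / y\<^sub>1\<^sup>n\<close> has \<open>x\<close>-degree exceeding its \<open>y\<close>-degree by \<open>n\<close>, so it
  is \<open>x\<^sup>\<alpha>\<close>, with \<open>|\<alpha>| = n\<close>, times a monomial of \<open>T\<close>.
\<close>

section \<open>Monomials and exponent vectors\<close>

lemma poly_mapping_eq_sum_single:
  fixes f :: "'a \<Rightarrow>\<^sub>0 'b::comm_monoid_add"
  shows "f = (\<Sum>m\<in>Poly_Mapping.keys f. Poly_Mapping.single m (Poly_Mapping.lookup f m))"
  by (rule poly_mapping_eqI)
    (auto simp: lookup_sum lookup_single when_def in_keys_iff sum.delta)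

lemma xvar_power: "xvar i ^ n = Poly_Mapping.single (Poly_Mapping.single (VX i) n) 1"
  by (induction n) (simp_all add: xvar_def mult_single single_add[symmetric])

lemma yvar_power: "yvar j ^ n = Poly_Mapping.single (Poly_Mapping.single (VY j) n) 1"
  by (induction n) (simp_all add: yvar_def mult_single single_add[symmetric])

lemma xvar_nonzero: "xvar i \<noteq> 0"
  by (metis keys_single keys_zero insert_not_empty xvar_def zero_neq_one)

lemma yvar_nonzero: "yvar j \<noteq> 0"
  by (metis keys_single keys_zero insert_not_empty yvar_def zero_neq_one)

lemma prod_single:
  "(\<Prod>i\<in>A. Poly_Mapping.single (e i) (1::'k::field)) = Poly_Mapping.single (\<Sum>i\<in>A. e i) 1"
  by (induction A rule: infinite_finite_induct) (auto simp: mult_single)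

lemma single_eq_xmonom_ymonom:
  assumes "Poly_Mapping.keys m \<subseteq> VX ` {1..r} \<union> VY ` {1..s}"
  shows "Poly_Mapping.single m c =
    const c * xmonom r (\<lambda>i. Poly_Mapping.lookup m (VX i)) * ymonom s (\<lambda>j. Poly_Mapping.lookup m (VY j))"
proof -
  \<comment> \<open>The support condition on \<open>m\<close> makes it the sum of its coordinates
    along the variables in range; \<open>prod_single\<close> then turns this sum of exponents into a
    product of powers.\<close>
  have "m = (\<Sum>i=1..r. Poly_Mapping.single (VX i) (Poly_Mapping.lookup m (VX i))) +
    (\<Sum>j=1..s. Poly_Mapping.single (VY j) (Poly_Mapping.lookup m (VY j)))" (is "m = ?m")
  proof (rule poly_mapping_eqI)
    fix v
    show "Poly_Mapping.lookup m v = Poly_Mapping.lookup ?m v"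
    proof (cases "v \<in> Poly_Mapping.keys m")
      case True
      then show ?thesis
        using assms by (auto simp: lookup_add lookup_sum lookup_single when_def)
    next
      case False
      then show ?thesis
        by (cases v) (auto simp: lookup_add lookup_sum lookup_single when_def in_keys_iff)
    qed
  qed
  then show ?thesis
    by (simp add: xmonom_def ymonom_def const_def xvar_power yvar_power prod_single mult_single)
qed

lemma xmonom_add: "xmonom r (\<lambda>i. \<alpha> i + \<alpha>' i) = xmonom r \<alpha> * xmonom r \<alpha>'"
  by (simp add: xmonom_def power_add prod.distrib)

lemma ymonom_add: "ymonom s (\<lambda>j. \<beta> j + \<beta>' j) = ymonom s \<beta> * ymonom s \<beta>'"
  by (simp add: ymonom_def power_add prod.distrib)

lemma ymonom_delta:
  assumes "j \<in> {1..s}"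
  shows "ymonom s (\<lambda>k. if k = j then n else 0) = yvar j ^ n"
proof -
  have "ymonom s (\<lambda>k. if k = j then n else 0) = (\<Prod>k=1..s. if k = j then yvar j ^ n else 1)"
    unfolding ymonom_def by (rule prod.cong) auto
  then show ?thesis
    using assms by simp
qed

text \<open>A nonzero sum has a positive entry, so units can be moved one at a time into \<alpha>'.
  The splitting is an equality of functions, also outside \<open>A\<close>, so that it can be
  rewritten inside \<open>xmonom\<close> and \<open>ymonom\<close>.\<close>

lemma split_exponent:
  fixes \<alpha> :: "'a \<Rightarrow> nat"
  assumes "finite A" "sum \<alpha> A = n + k"
  obtains \<alpha>' \<alpha>'' where "\<alpha> = (\<lambda>i. \<alpha>' i + \<alpha>'' i)" "sum \<alpha>' A = n" "sum \<alpha>'' A = k"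
proof -
  have "\<exists>\<alpha>' \<alpha>''. \<alpha> = (\<lambda>i. \<alpha>' i + \<alpha>'' i) \<and> sum \<alpha>' A = n \<and> sum \<alpha>'' A = k"
    using assms(2)
  proof (induction n arbitrary: \<alpha>)
    case 0
    then show ?case
      by (intro exI[of _ "\<lambda>_. 0"] exI[of _ \<alpha>]) auto
  next
    case (Suc n)
    then have "sum \<alpha> A \<noteq> 0"
      by simp
    then obtain i where i: "i \<in> A" "\<alpha> i \<noteq> 0"
      by (meson sum.neutral)
    define e where "e = (\<lambda>j. if j = i then 1 else 0 :: nat)"
    have e: "sum e A = 1"
      using assms(1) i by (simp add: e_def)
    \<comment> \<open>The truncated subtraction is exact because the entry at \<open>i\<close> is
      positive.\<close>
    have \<alpha>: "\<alpha> = (\<lambda>j. (\<alpha> j - e j) + e j)"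
      using i by (auto simp: e_def)
    then have "sum \<alpha> A = sum (\<lambda>j. \<alpha> j - e j) A + sum e A"
      by (metis (no_types) sum.distrib)
    then have "sum (\<lambda>j. \<alpha> j - e j) A = n + k"
      using Suc.prems e by simp
    from Suc.IH[OF this] obtain \<gamma> \<delta> where
      \<gamma>: "(\<lambda>j. \<alpha> j - e j) = (\<lambda>j. \<gamma> j + \<delta> j)" "sum \<gamma> A = n" "sum \<delta> A = k"
      by blast
    have "\<alpha> = (\<lambda>j. (\<gamma> j + e j) + \<delta> j)"
      using \<alpha> fun_cong[OF \<gamma>(1)] by (auto simp: fun_eq_iff)
    moreover have "sum (\<lambda>j. \<gamma> j + e j) A = Suc n"
      using \<gamma>(2) e by (simp add: sum.distrib)
    ultimately show ?case
      using \<gamma>(3) by (intro exI[of _ "\<lambda>j. \<gamma> j + e j"] exI[of _ \<delta>]) auto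
  qed
  then show ?thesis
    using that by blast
qed

section \<open>Monomials of the Segre product\<close>

lemma xmonom_ymonom_in_segre:
  assumes "(\<Sum>i=1..r. \<alpha> i) = n" "(\<Sum>j=1..s. \<beta> j) = n"
  shows "xmonom r \<alpha> * ymonom s \<beta> \<in> (segre r s :: 'k::field mpoly set)"
  using assms
proof (induction n arbitrary: \<alpha> \<beta>)
  case 0
  then have "xmonom r \<alpha> = (1 :: 'k mpoly)" "ymonom s \<beta> = (1 :: 'k mpoly)"
    by (simp_all add: xmonom_def ymonom_def)
  then show ?case
    by (simp add: one_in_segre)
next
  case (Suc n)
  \<comment> \<open>Splitting degree 1 off both exponent vectors isolates one generator x_i y_j,
    leaving a monomial of degree \<open>n\<close> in each set of variables.\<close>
  obtain \<alpha>' \<alpha>'' where \<alpha>: "\<alpha> = (\<lambda>i. \<alpha>' i + \<alpha>'' i)" "(\<Sum>i=1..r. \<alpha>' i) = 1" "(\<Sum>i=1..r. \<alpha>'' i) = n"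
    using split_exponent[of "{1..r}" \<alpha> 1 n] Suc.prems by auto
  obtain \<beta>' \<beta>'' where \<beta>: "\<beta> = (\<lambda>j. \<beta>' j + \<beta>'' j)" "(\<Sum>j=1..s. \<beta>' j) = 1" "(\<Sum>j=1..s. \<beta>'' j) = n"
    using split_exponent[of "{1..s}" \<beta> 1 n] Suc.prems by auto
  \<comment> \<open>Natural numbers with sum 1 form a unit vector, so the monomial is a single
    variable. The family \<open>v\<close> is arbitrary in order to serve both \<open>xvar\<close>
    and \<open>yvar\<close>.\<close>
  have unit: "\<exists>i\<in>{1..t}. (\<Prod>k=1..t. v k ^ \<gamma> k) = v i"
    if \<gamma>: "(\<Sum>k=1..t. \<gamma> k) = 1" for t \<gamma> and v :: "nat \<Rightarrow> 'k mpoly"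
  proof -
    obtain i where i: "i \<in> {1..t}" "\<gamma> i = 1" "\<forall>k\<in>{1..t}. k \<noteq> i \<longrightarrow> \<gamma> k = 0"
      using \<gamma> unfolding sum_eq_1_iff[OF finite_atLeastAtMost] by metis
    then have "(\<Prod>k=1..t. v k ^ \<gamma> k) = (\<Prod>k=1..t. if k = i then v i else 1)"
      by (intro prod.cong) auto
    then show ?thesis
      using i(1) by auto
  qed
  obtain i j where ij: "i \<in> {1..r}" "xmonom r \<alpha>' = (xvar i :: 'k mpoly)"
      "j \<in> {1..s}" "ymonom s \<beta>' = (yvar j :: 'k mpoly)"
    using unit[OF \<alpha>(2), of xvar] unit[OF \<beta>(2), of yvar] unfolding xmonom_def ymonom_def by blast
  have "(xvar i * yvar j) * (xmonom r \<alpha>'' * ymonom s \<beta>'') \<in> (segre r s :: 'k mpoly set)"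
  proof (rule mult_in_segre)
    show "xvar i * yvar j \<in> (segre r s :: 'k mpoly set)"
      using ij unfolding segre_def by (intro hull_inc) blast
  qed (rule Suc.IH[OF \<alpha>(3) \<beta>(3)])
  then show ?case
    unfolding \<alpha>(1) \<beta>(1) xmonom_add ymonom_add ij by (simp add: mult_ac)
qed

text \<open>These are the exponent vectors of the monomials of T: \<open>keys_segre_balanced\<close>
  gives one direction, \<open>xmonom_ymonom_in_segre\<close> the other. The support condition
  excludes the further variables of the ambient ring.\<close>

definition balanced :: "nat \<Rightarrow> nat \<Rightarrow> (var \<Rightarrow>\<^sub>0 nat) \<Rightarrow> bool" where
  "balanced r s m \<longleftrightarrow> Poly_Mapping.keys m \<subseteq> VX ` {1..r} \<union> VY ` {1..s} \<and>
    (\<Sum>i=1..r. Poly_Mapping.lookup m (VX i)) = (\<Sum>j=1..s. Poly_Mapping.lookup m (VY j))"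

lemma balanced_zero: "balanced r s 0"
  by (simp add: balanced_def)

lemma balanced_add: "balanced r s m \<Longrightarrow> balanced r s m' \<Longrightarrow> balanced r s (m + m')"
  using keys_add[of m m'] by (auto simp: balanced_def lookup_add sum.distrib)

text \<open>The polynomials with only balanced monomials form a subalgebra containing every x_i y_j,
  hence contain the hull.\<close>

lemma keys_segre_balanced:
  assumes "f \<in> (segre r s :: 'k::field mpoly set)" "m \<in> Poly_Mapping.keys f"
  shows "balanced r s m"
proof -
  let ?B = "{f :: 'k mpoly. \<forall>m\<in>Poly_Mapping.keys f. balanced r s m}"
  have "segre r s \<subseteq> ?B"
    unfolding segre_def
  proof (rule hull_minimal)
    show "subalgebra ?B"
      unfolding subalgebra_def
    proof (intro conjI ballI)
      show "range const \<subseteq> ?B"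
        by (auto simp: const_def balanced_zero split: if_splits)
      fix f g assume "f \<in> ?B" "g \<in> ?B"
      then show "f + g \<in> ?B" "f * g \<in> ?B"
        using keys_add[of f g] keys_mult[of f g] balanced_add by blast+
    qed
    have "balanced r s (Poly_Mapping.single (VX i) 1 + Poly_Mapping.single (VY j) 1)"
      if "i \<in> {1..r}" "j \<in> {1..s}" for i j
      using that keys_add[of "Poly_Mapping.single (VX i) (1::nat)" "Poly_Mapping.single (VY j) 1"]
      by (auto simp: balanced_def lookup_add lookup_single when_def)
    then show "{xvar i * yvar j | i j. i \<in> {1..r} \<and> j \<in> {1..s}} \<subseteq> ?B"
      by (auto simp: xvar_def yvar_def mult_single)
  qed
  then show ?thesis
    using assms by blast
qed

section \<open>Divisibility by a power of a variable\<close>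

lemma lookup_mult_single:
  fixes f :: "('a::cancel_comm_monoid_add) \<Rightarrow>\<^sub>0 ('b::semiring_0)"
  shows "Poly_Mapping.lookup (f * Poly_Mapping.single k c) (m + k) = Poly_Mapping.lookup f m * c"
proof -
  have "f * Poly_Mapping.single k c =
      (\<Sum>l\<in>Poly_Mapping.keys f. Poly_Mapping.single (l + k) (Poly_Mapping.lookup f l * c))"
    by (subst poly_mapping_eq_sum_single[of f]) (simp only: sum_distrib_right mult_single)
  \<comment> \<open>Cancellation of exponents leaves only the term with
    \<open>l = m\<close>.\<close>
  then show ?thesis
    by (auto simp: lookup_sum lookup_single when_def in_keys_iff)
qed

text \<open>Every monomial on the right has exponent at least \<open>n\<close> in y_i, while
  multiplication by y_j^n leaves that exponent of \<open>m\<close> unchanged and cancels no term of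
  \<open>f\<close>.\<close>

lemma le_lookup_of_mult_yvar_power_eq:
  assumes "f * yvar j ^ n = g * yvar i ^ n" "i \<noteq> j" "m \<in> Poly_Mapping.keys f"
  shows "n \<le> Poly_Mapping.lookup m (VY i)"
proof -
  let ?e = "\<lambda>l. Poly_Mapping.single (VY l) n"
  have "Poly_Mapping.lookup (f * yvar j ^ n) (m + ?e j) = Poly_Mapping.lookup f m"
    by (simp add: yvar_power lookup_mult_single)
  then have "m + ?e j \<in> Poly_Mapping.keys (g * yvar i ^ n)"
    using assms(1,3) by (simp add: in_keys_iff)
  then obtain l where "m + ?e j = l + ?e i"
    using keys_mult[of g "yvar i ^ n"] by (auto simp: yvar_power)
  then have "Poly_Mapping.lookup (m + ?e j) (VY i) = Poly_Mapping.lookup (l + ?e i) (VY i)"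
    by simp
  then show ?thesis
    using assms(2) by (simp add: lookup_add lookup_single)
qed

section \<open>The inverse as a module, and its generators\<close>

lemma submodule_hull: "submodule R (submodule R hull S)"
  by (rule hull_in) (auto simp: submodule_def)

lemma submodule_sum:
  assumes "submodule R M" "\<And>a. a \<in> A \<Longrightarrow> h a \<in> M"
  shows "sum h A \<in> M"
  using assms by (induction A rule: infinite_finite_induct) (auto simp: submodule_def)

text \<open>This allows the inclusion of the generated module in the inverse to be checked on
  generators.\<close>

lemma submodule_ideal_inverse:
  fixes R :: "'k::field mpoly set"
  assumes "subalgebra R"
  shows "submodule (to_fract ` R) (ideal_inverse R J)"
proof -
  have add: "f + g \<in> R" and mult: "f * g \<in> R" if "f \<in> R" "g \<in> R" for f g
    using assms that by (auto simp: subalgebra_def)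
  have "const c \<in> R" for c
    using assms by (auto simp: subalgebra_def)
  from this[of 0] this[of 1] have zero: "0 \<in> R" and one: "1 \<in> R"
    by (simp_all add: const_def)
  have fadd: "z + w \<in> fraction_field R" if zw: "z \<in> fraction_field R" "w \<in> fraction_field R" for z w
  proof -
    obtain a b c d where *: "z = Fract a b" "w = Fract c d"
        "a \<in> R" "b \<in> R" "c \<in> R" "d \<in> R" "b \<noteq> 0" "d \<noteq> 0"
      using zw by (auto simp: fraction_field_def)
    then have "z + w = Fract (a * d + c * b) (b * d)"
      by simp
    then show ?thesis
      using * add mult unfolding fraction_field_def by (metis (mono_tags, lifting) mem_Collect_eq mult_eq_0_iff)
  qed
  have fmult: "to_fract c * z \<in> fraction_field R" if cz: "c \<in> R" "z \<in> fraction_field R" for c z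
  proof -
    obtain a b where *: "z = Fract a b" "a \<in> R" "b \<in> R" "b \<noteq> 0"
      using cz by (auto simp: fraction_field_def)
    then have "to_fract c * z = Fract (c * a) b"
      by (simp add: to_fract_def)
    then show ?thesis
      using * cz mult unfolding fraction_field_def by blast
  qed
  show ?thesis
    unfolding submodule_def
  proof (intro conjI ballI)
    have "(0 :: 'k mpoly fract) = Fract 0 1"
      by (simp add: Zero_fract_def)
    then have "0 \<in> fraction_field R"
      using zero one unfolding fraction_field_def by fastforce
    then show "0 \<in> ideal_inverse R J"
      using zero by (auto simp: ideal_inverse_def image_iff intro: bexI[of _ 0])
  next
    fix z w assume "z \<in> ideal_inverse R J" "w \<in> ideal_inverse R J"
    then show "z + w \<in> ideal_inverse R J"
      using fadd add by (fastforce simp: ideal_inverse_def distrib_right image_iff simp flip: to_fract_add)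
  next
    fix c z assume c: "c \<in> to_fract ` R" and z: "z \<in> ideal_inverse R J"
    then show "c * z \<in> ideal_inverse R J"
      using fmult mult by (fastforce simp: ideal_inverse_def mult.assoc image_iff simp flip: to_fract_mult)
  qed
qed

text \<open>The elements of T that \<open>z\<close> multiplies into T form an ideal of T, which
  contains all of I once it contains the generators.\<close>

lemma ideal_inverse_canon_idealI:
  fixes z :: "'k::field mpoly fract"
  assumes "1 \<le> r" "z \<in> fraction_field (segre r s)"
    and "\<And>\<beta>. (\<Sum>j=1..s. \<beta> j) = r - s \<Longrightarrow>
      z * to_fract (xvar 1 ^ (r - s) * ymonom s \<beta>) \<in> to_fract ` segre r s"
  shows "z \<in> ideal_inverse (segre r s) (canon_ideal r s)"
proof -
  let ?T = "segre r s :: 'k mpoly set"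
  let ?J = "{a \<in> ?T. z * to_fract a \<in> to_fract ` ?T}"
  have alg: "range const \<subseteq> ?T" "\<forall>f\<in>?T. \<forall>g\<in>?T. f + g \<in> ?T"
    using subalgebra_segre[of r s] unfolding subalgebra_def by blast+
  have add: "f + g \<in> ?T" if "f \<in> ?T" "g \<in> ?T" for f g
    using alg that by blast
  have "(0 :: 'k mpoly) = const 0"
    by (simp add: const_def)
  then have zero: "0 \<in> ?T"
    using alg by blast
  have "canon_ideal r s \<subseteq> ?J"
    unfolding canon_ideal_def
  proof (rule hull_minimal)
    show "{xvar 1 ^ (r - s) * ymonom s \<beta> | \<beta>. (\<Sum>j=1..s. \<beta> j) = r - s} \<subseteq> ?J"
      using assms(3) canon_generator_in_segre[OF assms(1)] by blast
    show "ideal_of ?T ?J"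
      unfolding ideal_of_def submodule_def
    proof (intro conjI ballI)
      show "0 \<in> ?J"
        using zero by (auto simp: image_iff intro: bexI[of _ 0])
    next
      fix a b assume ab: "a \<in> ?J" "b \<in> ?J"
      then obtain t u where tu: "t \<in> ?T" "u \<in> ?T" "z * to_fract a = to_fract t" "z * to_fract b = to_fract u"
        by blast
      then have "z * to_fract (a + b) = to_fract (t + u)"
        by (simp add: distrib_left)
      then show "a + b \<in> ?J"
        using ab tu add by blast
    next
      fix c a assume c: "c \<in> ?T" and a: "a \<in> ?J"
      then obtain t where t: "t \<in> ?T" "z * to_fract a = to_fract t"
        by blast
      then have "z * to_fract (c * a) = to_fract (c * t)"
        by (simp add: mult.left_commute)
      then show "c * a \<in> ?J"
        using a c t mult_in_segre by blast
    qed blast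
  qed
  then show ?thesis
    using assms(2) by (auto simp: ideal_inverse_def)
qed

text \<open>Multiplying the fraction by a generator of I cancels the power of x_1 and leaves
  x^\<alpha> y^\<beta>, whose two degrees agree.\<close>

lemma anticanonical_generator_in_inverse:
  assumes "1 \<le> r" "1 \<le> s" "(\<Sum>i=1..r. \<alpha> i) = r - s"
  shows "Fract (xmonom r \<alpha>) (xvar 1 ^ (r - s)) \<in>
    ideal_inverse (segre r s) (canon_ideal r s :: 'k::field mpoly set)"
proof (rule ideal_inverse_canon_idealI[OF assms(1)])
  let ?n = "r - s"
  let ?T = "segre r s :: 'k mpoly set"
  let ?\<delta> = "\<lambda>k. if k = (1::nat) then ?n else 0"
  have y: "ymonom s ?\<delta> = (yvar 1 ^ ?n :: 'k mpoly)" and sum\<delta>: "(\<Sum>k=1..s. ?\<delta> k) = ?n"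
    using assms(2) ymonom_delta[of 1 s] by auto
  \<comment> \<open>For positive degree neither numerator nor denominator lies in T; both do after
    expansion by the same power of y_1.\<close>
  have "Fract (xmonom r \<alpha>) (xvar 1 ^ ?n) =
      Fract (xmonom r \<alpha> * yvar 1 ^ ?n) (xvar 1 ^ ?n * yvar 1 ^ ?n :: 'k mpoly)"
    by (simp add: eq_fract xvar_nonzero yvar_nonzero)
  moreover have "xmonom r \<alpha> * yvar 1 ^ ?n \<in> ?T"
    using xmonom_ymonom_in_segre[OF assms(3) sum\<delta>, where 'k='k] by (simp only: y)
  moreover have "xvar 1 ^ ?n * yvar 1 ^ ?n \<in> ?T"
    using canon_generator_in_segre[OF assms(1) sum\<delta>, where 'k='k] by (simp only: y)
  moreover have "xvar 1 ^ ?n * yvar 1 ^ ?n \<noteq> (0 :: 'k mpoly)"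
    by (simp add: xvar_nonzero yvar_nonzero)
  ultimately show "Fract (xmonom r \<alpha>) (xvar 1 ^ ?n) \<in> fraction_field ?T"
    unfolding fraction_field_def by blast
  fix \<beta> :: "nat \<Rightarrow> nat"
  assume \<beta>: "(\<Sum>j=1..s. \<beta> j) = ?n"
  have "Fract (xmonom r \<alpha>) (xvar 1 ^ ?n) * to_fract (xvar 1 ^ ?n * ymonom s \<beta> :: 'k mpoly) =
      to_fract (xmonom r \<alpha> * ymonom s \<beta>)"
    by (simp add: to_fract_def eq_fract xvar_nonzero)
  then show "Fract (xmonom r \<alpha>) (xvar 1 ^ ?n) * to_fract (xvar 1 ^ ?n * ymonom s \<beta> :: 'k mpoly)
      \<in> to_fract ` ?T"
    using xmonom_ymonom_in_segre[OF assms(3) \<beta>, where 'k='k] by (auto simp del: to_fract_mult)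
qed

text \<open>Dividing by y_1^n leaves an x-degree too large by \<open>n\<close>. The surplus is split
  off as \<alpha>; the remaining balanced monomial, with the coefficient, is
  \<open>h\<close>.\<close>

lemma balanced_monomial_over_denominator:
  fixes c :: "'k::field"
  assumes "1 \<le> s" "balanced r s m" "n \<le> Poly_Mapping.lookup m (VY 1)"
  obtains h \<alpha> where "h \<in> segre r s" "(\<Sum>i=1..r. \<alpha> i) = n"
    "Poly_Mapping.single m c = h * xmonom r \<alpha> * yvar 1 ^ n"
proof -
  let ?a = "\<lambda>i. Poly_Mapping.lookup m (VX i)" and ?b = "\<lambda>j. Poly_Mapping.lookup m (VY j)"
  define \<delta> where "\<delta> = (\<lambda>k. if k = (1::nat) then n else 0)"
  define \<beta> where "\<beta> = (\<lambda>j. ?b j - \<delta> j)"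
  have y: "ymonom s \<delta> = (yvar 1 ^ n :: 'k mpoly)" and sum\<delta>: "(\<Sum>k=1..s. \<delta> k) = n"
    using assms(1) ymonom_delta[of 1 s n] by (auto simp: \<delta>_def)
  \<comment> \<open>The lower bound on the exponent of y_1 makes the truncated subtraction in
    \<beta> exact.\<close>
  have b: "?b = (\<lambda>j. \<beta> j + \<delta> j)"
    using assms(3) by (auto simp: \<beta>_def \<delta>_def)
  have "(\<Sum>i=1..r. ?a i) = n + (\<Sum>j=1..s. \<beta> j)"
    using assms(2) sum\<delta> fun_cong[OF b] by (simp add: balanced_def sum.distrib)
  then obtain \<alpha> \<alpha>' where \<alpha>: "?a = (\<lambda>i. \<alpha> i + \<alpha>' i)" "(\<Sum>i=1..r. \<alpha> i) = n"
      "(\<Sum>i=1..r. \<alpha>' i) = (\<Sum>j=1..s. \<beta> j)"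
    by (rule split_exponent[OF finite_atLeastAtMost])
  have "Poly_Mapping.single m c = const c * xmonom r ?a * ymonom s ?b"
    by (rule single_eq_xmonom_ymonom) (use assms(2) in \<open>simp add: balanced_def\<close>)
  also have "\<dots> = const c * (xmonom r \<alpha>' * ymonom s \<beta>) * xmonom r \<alpha> * yvar 1 ^ n"
    unfolding \<alpha>(1) b xmonom_add ymonom_add y by (simp add: mult_ac)
  finally have eq: "Poly_Mapping.single m c = \<dots>" .
  have "const c \<in> segre r s"
    using subalgebra_segre[of r s] by (auto simp: subalgebra_def)
  then have "const c * (xmonom r \<alpha>' * ymonom s \<beta>) \<in> segre r s"
    using xmonom_ymonom_in_segre[OF \<alpha>(3) refl] by (rule mult_in_segre)
  then show ?thesis
    using that \<alpha>(2) eq by blast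
qed

theorem proposition4p17:
  fixes r s :: nat
  assumes "s \<ge> 2" and "r \<ge> s"
  shows "ideal_inverse (segre r s) (canon_ideal r s :: 'k::field mpoly set) =
    submodule (to_fract ` segre r s) hull
      {Fract (xmonom r \<alpha>) (xvar 1 ^ (r - s)) | \<alpha>. (\<Sum>i=1..r. \<alpha> i) = r - s}"
    (is "?L = submodule ?T hull ?G")
\<comment> \<open>For the inclusion of the hull in the inverse, minimality leaves only the
  generators to check.\<close>
proof (intro subset_antisym hull_minimal submodule_ideal_inverse subalgebra_segre)
  show "?G \<subseteq> ?L"
    proof
    fix w :: "'k mpoly fract"
    assume "w \<in> ?G"
    then obtain \<alpha> where "w = Fract (xmonom r \<alpha>) (xvar 1 ^ (r - s))" "(\<Sum>i=1..r. \<alpha> i) = r - s"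
      by blast
    then show "w \<in> ?L"
      using anticanonical_generator_in_inverse[of r s \<alpha>] assms by simp
  qed
  let ?n = "r - s"
  show "?L \<subseteq> submodule ?T hull ?G"
  proof
    fix z assume z: "z \<in> ?L"
    \<comment> \<open>The generator of I tested here has \<beta> concentrated at
      \<open>j\<close>.\<close>
    have *: "\<exists>f\<in>segre r s. z * to_fract (xvar 1 ^ ?n * yvar j ^ ?n) = to_fract f"
      if "j \<in> {1..s}" for j
    proof -
      have "xvar 1 ^ ?n * ymonom s (\<lambda>k. if k = j then ?n else 0) \<in> (canon_ideal r s :: 'k mpoly set)"
        unfolding canon_ideal_def using that by (intro hull_inc) auto
      then show ?thesis
        using z unfolding ymonom_delta[OF that] ideal_inverse_def by blast
    qed
    obtain f where f: "f \<in> segre r s" "z * to_fract (xvar 1 ^ ?n * yvar 1 ^ ?n) = to_fract f"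
      using *[of 1] assms by auto
    \<comment> \<open>Here \<open>s \<ge> 2\<close> supplies a second variable y_2, coprime to
      y_1.\<close>
    obtain g where g: "z * to_fract (xvar 1 ^ ?n * yvar 2 ^ ?n) = to_fract g"
      using *[of 2] assms by auto
    \<comment> \<open>Both sides are z x_1^n y_1^n y_2^n; injectivity of \<open>to_fract\<close>
      brings the identity back to polynomials.\<close>
    have "to_fract (f * yvar 2 ^ ?n) = to_fract (g * yvar 1 ^ ?n)"
      by (simp add: f(2)[symmetric] g[symmetric] mult_ac)
    then have fg: "f * yvar 2 ^ ?n = g * yvar 1 ^ ?n"
      unfolding to_fract_eq_iff .
    let ?D = "to_fract (xvar 1 ^ ?n * yvar 1 ^ ?n :: 'k mpoly)"
    have D: "?D \<noteq> 0"
      by (simp add: xvar_nonzero yvar_nonzero del: to_fract_mult)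
    have "z = to_fract f / ?D"
      using f(2) D by (simp add: field_simps del: to_fract_mult)
    \<comment> \<open>The terms of \<open>f\<close> can be treated separately, since each one
      divided by \<open>?D\<close> already lies in the generated module.\<close>
    also have "\<dots> = (\<Sum>m\<in>Poly_Mapping.keys f. to_fract (Poly_Mapping.single m (Poly_Mapping.lookup f m)) / ?D)"
      by (subst poly_mapping_eq_sum_single[of f]) (simp only: to_fract_sum sum_divide_distrib)
    also have "\<dots> \<in> submodule ?T hull ?G"
    proof (rule submodule_sum[OF submodule_hull])
      fix m assume m: "m \<in> Poly_Mapping.keys f"
      obtain h \<alpha> where h: "h \<in> segre r s" "(\<Sum>i=1..r. \<alpha> i) = ?n"
          "Poly_Mapping.single m (Poly_Mapping.lookup f m) = h * xmonom r \<alpha> * yvar 1 ^ ?n"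
        using balanced_monomial_over_denominator[of s r m ?n "Poly_Mapping.lookup f m"] assms
          keys_segre_balanced[OF f(1) m] le_lookup_of_mult_yvar_power_eq[OF fg _ m] by auto
      \<comment> \<open>The power of y_1 cancels, leaving an element of T times one of the proposed
        generators.\<close>
      have "to_fract (Poly_Mapping.single m (Poly_Mapping.lookup f m)) / ?D =
          to_fract h * Fract (xmonom r \<alpha>) (xvar 1 ^ ?n)"
        unfolding h(3) Fract_conv_to_fract[symmetric]
        by (simp add: to_fract_def eq_fract xvar_nonzero yvar_nonzero mult_ac)
      moreover have "Fract (xmonom r \<alpha>) (xvar 1 ^ ?n) \<in> submodule ?T hull ?G"
        using h(2) by (intro hull_inc) auto
      ultimately show "to_fract (Poly_Mapping.single m (Poly_Mapping.lookup f m)) / ?D \<in> submodule ?T hull ?G"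
        using submodule_hull[of ?T ?G] h(1) by (auto simp: submodule_def)
    qed
    finally show "z \<in> submodule ?T hull ?G" .
  qed
qed

end
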